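(* Let $P_0(r)=r^8+64r^6+1152r^4+9216r^2+36864$ and $\Phi_2(r)=\dfrac{r^2(r^2+24)}{\sqrt{P_0(r)}}$. For $m=\pm3$, the linearized operator $\mathcal{L}_{2,m}$ at the degree-2 vortex $\Phi_2$ has the nontrivial kernel element $(u_{\pm3},v_{\pm3})$, i.e. $\mathcal{L}_{2,\pm3}\binom{u_{\pm3}}{v_{\pm3}}=0$ on $(0,\infty)$, where $$u_{\pm3}=\frac{-24r\,(r^6+32r^4+384r^2+1536)}{P_0^{3/2}},\qquad v_{\pm3}=\frac{\pm r}{\sqrt{P_0}} .$$
   Context: For $m\in\mathbb{Z}$ the operator $\mathcal{L}_{2,m}$ acts on pairs of functions $(u,v)^T$ of $r\in(0,\infty)$ by $$\mathcal{L}_{2,m}\binom uv=\binom{-u''-\frac1ru'+\mathfrak{B}u'+\frac{m^2}{r^2}u+(\mathfrak{C}+\mathfrak{D})u+m\mathfrak{A}v}{-v''-\frac1rv'+\mathfrak{B}v'+\frac{m^2}{r^2}v+(\mathfrak{C}-\mathfrak{D})v+m\mathfrak{A}u},$$ where, with $n=2$ and $\Phi=\Phi_2$, $$\mathfrak{A}=\frac{4n}{r^2}\frac1{2-\Phi^2},\qquad \mathfrak{B}=-\frac{2\Phi\Phi'}{2-\Phi^2},$$ $$\mathfrak{C}=\frac{n^2}{r^2}\frac4{(2-\Phi^2)^2}-\frac{(\Phi')^2\Phi^2}{(2-\Phi^2)^2}-\frac32\Phi^4+3\Phi^2-1,$$ $$\mathfrak{D}=\frac{n^2}{r^2}\frac{2\Phi^2}{(2-\Phi^2)^2}-\frac{2(\Phi')^2}{(2-\Phi^2)^2}-\Phi^4+\frac32\Phi^2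 .$$ *)

theory Defs
  imports "HOL-Analysis.Analysis"
begin

definition coeff_A :: "int \<Rightarrow> (real \<Rightarrow> real) \<Rightarrow> real \<Rightarrow> real" where
  "coeff_A n \<Phi> r = 4 * real_of_int n / r\<^sup>2 * (1 / (2 - (\<Phi> r)\<^sup>2))"

definition coeff_B :: "(real \<Rightarrow> real) \<Rightarrow> real \<Rightarrow> real" where
  "coeff_B \<Phi> r = - (2 * \<Phi> r * deriv \<Phi> r / (2 - (\<Phi> r)\<^sup>2))"

definition coeff_C :: "int \<Rightarrow> (real \<Rightarrow> real) \<Rightarrow> real \<Rightarrow> real" where
  "coeff_C n \<Phi> r =
     (real_of_int n)\<^sup>2 / r\<^sup>2 * (4 / (2 - (\<Phi> r)\<^sup>2)\<^sup>2)
     - (deriv \<Phi> r)\<^sup>2 * (\<Phi> r)\<^sup>2 / (2 - (\<Phi> r)\<^sup>2)\<^sup>2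
     - 3 / 2 * (\<Phi> r) ^ 4 + 3 * (\<Phi> r)\<^sup>2 - 1"

definition coeff_D :: "int \<Rightarrow> (real \<Rightarrow> real) \<Rightarrow> real \<Rightarrow> real" where
  "coeff_D n \<Phi> r =
     (real_of_int n)\<^sup>2 / r\<^sup>2 * (2 * (\<Phi> r)\<^sup>2 / (2 - (\<Phi> r)\<^sup>2)\<^sup>2)
     - 2 * (deriv \<Phi> r)\<^sup>2 / (2 - (\<Phi> r)\<^sup>2)\<^sup>2
     - (\<Phi> r) ^ 4 + 3 / 2 * (\<Phi> r)\<^sup>2"

text \<open>The functions live on the half-line \<open>r > 0\<close>; values at \<open>r \<le> 0\<close> carry no meaning.\<close>

definition lin_op ::
  "int \<Rightarrow> (real \<Rightarrow> real) \<Rightarrow> int \<Rightarrow> (real \<Rightarrow> real) \<times> (real \<Rightarrow> real) \<Rightarrow> (real \<Rightarrow> real) \<times> (real \<Rightarrow> real)"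
where
  "lin_op n \<Phi> m = (\<lambda>(u, v).
     (\<lambda>r. - deriv (deriv u) r - 1 / r * deriv u r + coeff_B \<Phi> r * deriv u r
          + (real_of_int m)\<^sup>2 / r\<^sup>2 * u r
          + (coeff_C n \<Phi> r + coeff_D n \<Phi> r) * u r
          + real_of_int m * coeff_A n \<Phi> r * v r,
      \<lambda>r. - deriv (deriv v) r - 1 / r * deriv v r + coeff_B \<Phi> r * deriv v r
          + (real_of_int m)\<^sup>2 / r\<^sup>2 * v r
          + (coeff_C n \<Phi> r - coeff_D n \<Phi> r) * v r
          + real_of_int m * coeff_A n \<Phi> r * u r))"

definition P0 :: "real \<Rightarrow> real" where
  "P0 r = r ^ 8 + 64 * r ^ 6 + 1152 * r ^ 4 + 9216 * r\<^sup>2 + 36864"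

definition Phi2 :: "real \<Rightarrow> real" where
  "Phi2 r = r\<^sup>2 * (r\<^sup>2 + 24) / sqrt (P0 r)"

definition L2 ::
  "int \<Rightarrow> (real \<Rightarrow> real) \<times> (real \<Rightarrow> real) \<Rightarrow> (real \<Rightarrow> real) \<times> (real \<Rightarrow> real)" where
  "L2 m = lin_op 2 Phi2 m"

definition twice_differentiable_pos :: "(real \<Rightarrow> real) \<Rightarrow> bool" where
  "twice_differentiable_pos f \<longleftrightarrow>
     (\<forall>r>0. f differentiable (at r) \<and> deriv f differentiable (at r))"

text \<open>Since \<^const>\<open>deriv\<close> is total, twice differentiability is required explicitly:
  the two equations are meant in the classical sense at every \<open>r > 0\<close>.\<close>

definition nontrivial_kernel_element ::
  "((real \<Rightarrow> real) \<times> (real \<Rightarrow> real) \<Rightarrow> (real \<Rightarrow> real) \<times> (real \<Rightarrow> real)) \<Rightarrow>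
   (real \<Rightarrow> real) \<times> (real \<Rightarrow> real) \<Rightarrow> bool" where
  "nontrivial_kernel_element L w \<longleftrightarrow>
     twice_differentiable_pos (fst w) \<and> twice_differentiable_pos (snd w) \<and>
     (\<forall>r>0. fst (L w) r = 0 \<and> snd (L w) r = 0) \<and>
     (\<exists>r>0. fst w r \<noteq> 0 \<or> snd w r \<noteq> 0)"

text \<open>Neither division by zero nor a meaningless \<^term>\<open>deriv Phi2\<close> occurs in the
  coefficients of \<^const>\<open>L2\<close>.\<close>

lemma P0_pos: "P0 r > 0"
  unfolding P0_def by (intro add_nonneg_pos add_nonneg_nonneg) auto

lemma Phi2_sq_less_one: "(Phi2 r)\<^sup>2 < 1"
proof -
  have "P0 r - (r\<^sup>2 * (r\<^sup>2 + 24))\<^sup>2 = 16 * r ^ 6 + 576 * r ^ 4 + 9216 * r\<^sup>2 + 36864"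
    by (simp add: P0_def power2_eq_square eval_nat_numeral algebra_simps)
  also have "\<dots> > 0"
    by (intro add_nonneg_pos add_nonneg_nonneg) auto
  finally have "(r\<^sup>2 * (r\<^sup>2 + 24))\<^sup>2 < P0 r" by simp
  moreover have "(Phi2 r)\<^sup>2 = (r\<^sup>2 * (r\<^sup>2 + 24))\<^sup>2 / P0 r"
    using P0_pos[of r] by (simp add: Phi2_def power_divide)
  ultimately show ?thesis
    using P0_pos[of r] by simp
qed

lemma Phi2_differentiable: "Phi2 differentiable (at r)"
proof -
  have "\<exists>D. (Phi2 has_real_derivative D) (at r)"
    unfolding Phi2_def P0_def
    using P0_pos[of r]
    by (intro exI) (rule derivative_eq_intros refl | simp add: P0_def)+
  then show ?thesis
    using real_differentiable_def by blast
qed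

end

theory Submission
  imports Defs
begin

text \<open>
  Every function involved is a rational function of \<open>r\<close> times a power of \<open>1 / sqrt (P0 r)\<close>:
  writing \<open>Phi2 = f / sqrt P0\<close> one has \<open>2 - Phi2\<^sup>2 = Q0 / P0\<close> with a positive polynomial \<open>Q0\<close>,
  and the derivative of \<open>F / (P0^j sqrt P0)\<close> is
  \<open>(F' P0 - (j + 1/2) F P0') / (P0^(j+1) sqrt P0)\<close>. After multiplication by the positive factor
  \<open>r\<^sup>2 P0\<^sup>k Q0\<^sup>2 sqrt P0\<close>, with \<open>k = 3\<close> for the first and \<open>k = 2\<close> for the second component,
  each of the two equations becomes a polynomial identity in \<open>r\<close>.
  The case \<open>m = -3\<close> follows since the equations are invariant under \<open>(m, v) \<mapsto> (-m, -v)\<close>.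
\<close>

section \<open>Explicit polynomial numerators\<close>

definition dP0 :: "real \<Rightarrow> real" where
  "dP0 r = 8 * r ^ 7 + 384 * r ^ 5 + 4608 * r ^ 3 + 18432 * r"

definition Q0 :: "real \<Rightarrow> real" where
  "Q0 r = r ^ 8 + 80 * r ^ 6 + 1728 * r ^ 4 + 18432 * r\<^sup>2 + 73728"

text \<open>The numerators of \<open>Phi2'\<close>, \<open>u\<close>, \<open>u'\<close>,
  \<open>u''\<close>, \<open>v'\<close>, \<open>v''\<close> belong over
  \<open>P0^k * sqrt P0\<close> with k = 1, 1, 2, 3, 1, 2 respectively; the ones for
  \<open>v\<close> refer to m = 3.\<close>

definition numer_dPhi2 :: "real \<Rightarrow> real" where
  "numer_dPhi2 r = 16 * r * (r ^ 8 + 48 * r ^ 6 + 1728 * r ^ 4 + 23040 * r\<^sup>2 + 110592)"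

definition numer_u :: "real \<Rightarrow> real" where
  "numer_u r = - 24 * r * (r ^ 6 + 32 * r ^ 4 + 384 * r\<^sup>2 + 1536)"

definition numer_du :: "real \<Rightarrow> real" where
  "numer_du r = 24 * (5 * r ^ 14 + 352 * r ^ 12 + 10496 * r ^ 10 + 164352 * r ^ 8 + 1265664 * r ^ 6
     + 2949120 * r ^ 4 - 14155776 * r\<^sup>2 - 56623104)"

definition numer_ddu :: "real \<Rightarrow> real" where
  "numer_ddu r = - 720 * r ^ 21 - 75264 * r ^ 19 - 3588096 * r ^ 17 - 98525184 * r ^ 15
     - 1585446912 * r ^ 13 - 12372148224 * r ^ 11 + 18232639488 * r ^ 9 + 1263827681280 * r ^ 7
     + 10502000345088 * r ^ 5 + 35485019799552 * r ^ 3 + 37572373905408 * r"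

definition numer_dv :: "real \<Rightarrow> real" where
  "numer_dv r = - 3 * r ^ 8 - 128 * r ^ 6 - 1152 * r ^ 4 + 36864"

definition numer_ddv :: "real \<Rightarrow> real" where
  "numer_ddv r = 12 * r ^ 15 + 960 * r ^ 13 + 26880 * r ^ 11 + 230400 * r ^ 9 - 2211840 * r ^ 7
     - 60162048 * r ^ 5 - 424673280 * r ^ 3 - 1019215872 * r"

text \<open>Numerator over the common denominator
  \<open>r\<^sup>2 * P0\<^sup>2 * Q0\<^sup>2\<close>, left unexpanded so that it can be compared
  with the coefficient term by term.\<close>

definition numer_C :: "real \<Rightarrow> real" where
  "numer_C r = (let f = r\<^sup>2 * (r\<^sup>2 + 24) in
     16 * P0 r ^ 4 - f\<^sup>2 * (numer_dPhi2 r)\<^sup>2 * r\<^sup>2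
     + (- 3 / 2 * f ^ 4 + 3 * f\<^sup>2 * P0 r - (P0 r)\<^sup>2) * r\<^sup>2 * (Q0 r)\<^sup>2)"

definition numer_D :: "real \<Rightarrow> real" where
  "numer_D r = (let f = r\<^sup>2 * (r\<^sup>2 + 24) in
     8 * f\<^sup>2 * P0 r ^ 3 - 2 * (numer_dPhi2 r)\<^sup>2 * P0 r * r\<^sup>2
     + (- (f ^ 4) + 3 / 2 * f\<^sup>2 * P0 r) * r\<^sup>2 * (Q0 r)\<^sup>2)"

lemma Q0_pos: "Q0 r > 0"
  unfolding Q0_def by (intro add_nonneg_pos add_nonneg_nonneg) auto

lemma P0_powr_3_2: "P0 r powr (3 / 2) = P0 r * sqrt (P0 r)"
proof -
  have "P0 r powr (3 / 2) = P0 r powr (1 + 1 / 2)" by simp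
  also have "\<dots> = P0 r powr 1 * P0 r powr (1 / 2)" by (rule powr_add)
  finally show ?thesis using P0_pos[of r] by (simp add: powr_half_sqrt)
qed

section \<open>Derivatives of the profile and of the kernel functions\<close>

lemma has_real_derivative_P0: "(P0 has_real_derivative dP0 r) (at r)"
  unfolding P0_def[abs_def] dP0_def
  by (auto intro!: derivative_eq_intros)

text \<open>Quotient rule with one factor \<open>P0 r ^ j\<close> cancelled. Having \<open>N\<close>
  as a parameter lets each application supply the numerator in expanded form, which leaves a
  polynomial identity to check.\<close>

lemma has_real_derivative_divide_P0_power:
  assumes F: "(F has_real_derivative F') (at r)"
    and N: "F' * P0 r - (real j + 1 / 2) * F r * dP0 r = N"
  shows "((\<lambda>r. F r / (P0 r ^ j * sqrt (P0 r))) has_real_derivative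
           N / (P0 r ^ Suc j * sqrt (P0 r))) (at r)"
proof -
  note P = P0_pos[of r]
  have S: "sqrt (P0 r) * sqrt (P0 r) = P0 r" using P by simp
  have S': "sqrt (P0 r) * (sqrt (P0 r) * x) = P0 r * x" for x
    using S by (simp flip: mult.assoc)
  \<comment> \<open>For j = 0 the subtraction truncates, but the factor \<open>real j\<close> makes
    both sides vanish.\<close>
  have J: "real j * P0 r ^ (j - Suc 0) = real j * P0 r ^ j / P0 r"
    using P by (cases j) auto
  have "((\<lambda>r. P0 r ^ j * sqrt (P0 r)) has_real_derivative
          (real j + 1 / 2) * P0 r ^ j * dP0 r / sqrt (P0 r)) (at r)"
  proof (rule DERIV_cong)
    show "((\<lambda>r. P0 r ^ j * sqrt (P0 r)) has_real_derivative
          real j * P0 r ^ (j - Suc 0) * dP0 r * sqrt (P0 r)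
            + P0 r ^ j * (dP0 r / (2 * sqrt (P0 r)))) (at r)"
      using P by (auto intro!: derivative_eq_intros has_real_derivative_P0 simp: field_simps)
    show "real j * P0 r ^ (j - Suc 0) * dP0 r * sqrt (P0 r)
            + P0 r ^ j * (dP0 r / (2 * sqrt (P0 r)))
        = (real j + 1 / 2) * P0 r ^ j * dP0 r / sqrt (P0 r)"
      unfolding J using P by (simp add: field_simps S S')
  qed
  note D = DERIV_divide[OF F this]
  have "P0 r ^ j * sqrt (P0 r) \<noteq> 0" using P by simp
  from D[OF this] show ?thesis
    unfolding N[symmetric]
    by (rule DERIV_cong) (use P in \<open>simp add: field_simps S S'\<close>)
qed

lemma deriv_Phi2: "deriv Phi2 r = numer_dPhi2 r / (P0 r * sqrt (P0 r))"
proof -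
  have "((\<lambda>r. (r\<^sup>2 * (r\<^sup>2 + 24)) / (P0 r ^ 0 * sqrt (P0 r))) has_real_derivative
          numer_dPhi2 r / (P0 r ^ Suc 0 * sqrt (P0 r))) (at r)"
  proof (rule has_real_derivative_divide_P0_power)
    show "((\<lambda>r. r\<^sup>2 * (r\<^sup>2 + 24)) has_real_derivative 4 * r ^ 3 + 48 * r) (at r)"
      by (auto intro!: derivative_eq_intros simp: eval_nat_numeral algebra_simps)
    show "(4 * r ^ 3 + 48 * r) * P0 r - (real 0 + 1 / 2) * (r\<^sup>2 * (r\<^sup>2 + 24)) * dP0 r = numer_dPhi2 r"
      unfolding P0_def dP0_def numer_dPhi2_def of_nat_0 by algebra
  qed
  then show ?thesis
    by (simp add: DERIV_imp_deriv Phi2_def[abs_def])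
qed

lemma has_real_derivative_u:
  "((\<lambda>r. numer_u r / (P0 r * sqrt (P0 r))) has_real_derivative
     numer_du r / (P0 r ^ 2 * sqrt (P0 r))) (at r)"
proof -
  have "((\<lambda>r. numer_u r / (P0 r ^ 1 * sqrt (P0 r))) has_real_derivative
          numer_du r / (P0 r ^ Suc 1 * sqrt (P0 r))) (at r)"
  proof (rule has_real_derivative_divide_P0_power)
    show "(numer_u has_real_derivative - 24 * (7 * r ^ 6 + 160 * r ^ 4 + 1152 * r\<^sup>2 + 1536)) (at r)"
      unfolding numer_u_def[abs_def]
      by (auto intro!: derivative_eq_intros simp: eval_nat_numeral algebra_simps)
    show "- 24 * (7 * r ^ 6 + 160 * r ^ 4 + 1152 * r\<^sup>2 + 1536) * P0 r
        - (real 1 + 1 / 2) * numer_u r * dP0 r = numer_du r"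
      unfolding P0_def dP0_def numer_u_def numer_du_def of_nat_1 by algebra
  qed
  then show ?thesis by (simp add: numeral_2_eq_2)
qed

lemma has_real_derivative_du:
  "((\<lambda>r. numer_du r / (P0 r ^ 2 * sqrt (P0 r))) has_real_derivative
     numer_ddu r / (P0 r ^ 3 * sqrt (P0 r))) (at r)"
proof -
  have "((\<lambda>r. numer_du r / (P0 r ^ 2 * sqrt (P0 r))) has_real_derivative
          numer_ddu r / (P0 r ^ Suc 2 * sqrt (P0 r))) (at r)"
  proof (rule has_real_derivative_divide_P0_power)
    show "(numer_du has_real_derivative 24 * (70 * r ^ 13 + 4224 * r ^ 11 + 104960 * r ^ 9
        + 1314816 * r ^ 7 + 7593984 * r ^ 5 + 11796480 * r ^ 3 - 28311552 * r)) (at r)"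
      unfolding numer_du_def[abs_def]
      by (auto intro!: derivative_eq_intros)
    show "24 * (70 * r ^ 13 + 4224 * r ^ 11 + 104960 * r ^ 9
        + 1314816 * r ^ 7 + 7593984 * r ^ 5 + 11796480 * r ^ 3 - 28311552 * r) * P0 r
        - (real 2 + 1 / 2) * numer_du r * dP0 r = numer_ddu r"
      unfolding P0_def dP0_def numer_du_def numer_ddu_def of_nat_numeral by algebra
  qed
  then show ?thesis by (simp add: numeral_2_eq_2 numeral_3_eq_3)
qed

text \<open>The constant \<open>c\<close> will be the sign of m.\<close>

lemma has_real_derivative_v:
  "((\<lambda>r. c * r / sqrt (P0 r)) has_real_derivative c * numer_dv r / (P0 r * sqrt (P0 r))) (at r)"
proof -
  have "((\<lambda>r. c * r / (P0 r ^ 0 * sqrt (P0 r))) has_real_derivative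
          c * numer_dv r / (P0 r ^ Suc 0 * sqrt (P0 r))) (at r)"
  proof (rule has_real_derivative_divide_P0_power)
    show "((\<lambda>r. c * r) has_real_derivative c) (at r)"
      by (auto intro!: derivative_eq_intros)
    show "c * P0 r - (real 0 + 1 / 2) * (c * r) * dP0 r = c * numer_dv r"
      unfolding P0_def dP0_def numer_dv_def of_nat_0 by algebra
  qed
  then show ?thesis by simp
qed

lemma has_real_derivative_dv:
  "((\<lambda>r. c * numer_dv r / (P0 r * sqrt (P0 r))) has_real_derivative
     c * numer_ddv r / (P0 r ^ 2 * sqrt (P0 r))) (at r)"
proof -
  have "((\<lambda>r. c * numer_dv r / (P0 r ^ 1 * sqrt (P0 r))) has_real_derivative
          c * numer_ddv r / (P0 r ^ Suc 1 * sqrt (P0 r))) (at r)"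
  proof (rule has_real_derivative_divide_P0_power)
    show "((\<lambda>r. c * numer_dv r) has_real_derivative
        c * (- 24 * r ^ 7 - 768 * r ^ 5 - 4608 * r ^ 3)) (at r)"
      unfolding numer_dv_def[abs_def]
      by (auto intro!: derivative_eq_intros)
    show "c * (- 24 * r ^ 7 - 768 * r ^ 5 - 4608 * r ^ 3) * P0 r
        - (real 1 + 1 / 2) * (c * numer_dv r) * dP0 r = c * numer_ddv r"
      unfolding P0_def dP0_def numer_dv_def numer_ddv_def of_nat_1 by algebra
  qed
  then show ?thesis by (simp add: numeral_2_eq_2)
qed

section \<open>The coefficients as rational functions of r\<close>

lemma Phi2_sq: "(Phi2 r)\<^sup>2 = (r\<^sup>2 * (r\<^sup>2 + 24))\<^sup>2 / P0 r"
  using P0_pos[of r] by (simp add: Phi2_def power_divide)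

lemma Phi2_power4: "Phi2 r ^ 4 = (r\<^sup>2 * (r\<^sup>2 + 24)) ^ 4 / (P0 r)\<^sup>2"
  using arg_cong[OF Phi2_sq, of "\<lambda>x. x\<^sup>2" r] by (simp add: power_divide)

lemma two_minus_Phi2_sq: "2 - (Phi2 r)\<^sup>2 = Q0 r / P0 r"
proof -
  have "2 * P0 r - (r\<^sup>2 * (r\<^sup>2 + 24))\<^sup>2 = Q0 r"
    unfolding P0_def Q0_def by algebra
  then show ?thesis
    using P0_pos[of r] by (simp add: Phi2_sq field_simps)
qed

lemma deriv_Phi2_sq: "(deriv Phi2 r)\<^sup>2 = (numer_dPhi2 r)\<^sup>2 / P0 r ^ 3"
  using P0_pos[of r]
  by (simp add: deriv_Phi2 power_divide power_mult_distrib power2_eq_square power3_eq_cube)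

lemma Phi2_mult_deriv: "Phi2 r * deriv Phi2 r = r\<^sup>2 * (r\<^sup>2 + 24) * numer_dPhi2 r / (P0 r)\<^sup>2"
  using P0_pos[of r] by (simp add: deriv_Phi2 Phi2_def power2_eq_square)

lemma coeff_A_Phi2: "coeff_A 2 Phi2 r = 8 * P0 r / (r\<^sup>2 * Q0 r)"
  by (simp add: coeff_A_def two_minus_Phi2_sq)

lemma coeff_B_Phi2: "coeff_B Phi2 r = - (2 * (r\<^sup>2 * (r\<^sup>2 + 24)) * numer_dPhi2 r) / (P0 r * Q0 r)"
  using P0_pos[of r] Q0_pos[of r]
  \<comment> \<open>Reassociating isolates \<open>Phi2 r * deriv Phi2 r\<close>, in which the two
    square roots combine to \<open>P0 r\<close>.\<close>
  unfolding coeff_B_def two_minus_Phi2_sq mult.assoc[of 2] Phi2_mult_deriv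
  by (simp add: power2_eq_square)

lemma coeff_C_Phi2:
  assumes "r > 0"
  shows "coeff_C 2 Phi2 r = numer_C r / (r\<^sup>2 * (P0 r)\<^sup>2 * (Q0 r)\<^sup>2)"
proof -
  define f where "f = r\<^sup>2 * (r\<^sup>2 + 24)"
  show ?thesis
    using P0_pos[of r] Q0_pos[of r] assms
    unfolding coeff_C_def two_minus_Phi2_sq
    unfolding deriv_Phi2_sq Phi2_power4 Phi2_sq numer_C_def Let_def f_def[symmetric]
    by (simp add: divide_simps) algebra
qed

lemma coeff_D_Phi2:
  assumes "r > 0"
  shows "coeff_D 2 Phi2 r = numer_D r / (r\<^sup>2 * (P0 r)\<^sup>2 * (Q0 r)\<^sup>2)"
proof -
  define f where "f = r\<^sup>2 * (r\<^sup>2 + 24)"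
  show ?thesis
    using P0_pos[of r] Q0_pos[of r] assms
    unfolding coeff_D_def two_minus_Phi2_sq
    unfolding deriv_Phi2_sq Phi2_power4 Phi2_sq numer_D_def Let_def f_def[symmetric]
    by (simp add: divide_simps) algebra
qed

lemma first_component_eq_0:
  assumes "r > 0"
  shows "- (numer_ddu r / (P0 r ^ 3 * sqrt (P0 r))) - 1 / r * (numer_du r / (P0 r ^ 2 * sqrt (P0 r)))
      + coeff_B Phi2 r * (numer_du r / (P0 r ^ 2 * sqrt (P0 r)))
      + 9 / r\<^sup>2 * (numer_u r / (P0 r * sqrt (P0 r)))
      + (coeff_C 2 Phi2 r + coeff_D 2 Phi2 r) * (numer_u r / (P0 r * sqrt (P0 r)))
      + 3 * coeff_A 2 Phi2 r * (r / sqrt (P0 r)) = 0" (is "?lhs = 0")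
proof -
  define f where "f = r\<^sup>2 * (r\<^sup>2 + 24)"
  define N where "N = - numer_ddu r * r\<^sup>2 * (Q0 r)\<^sup>2 - numer_du r * r * P0 r * (Q0 r)\<^sup>2
       - 2 * f * numer_dPhi2 r * numer_du r * r\<^sup>2 * Q0 r + 9 * numer_u r * (P0 r)\<^sup>2 * (Q0 r)\<^sup>2
       + (numer_C r + numer_D r) * numer_u r + 24 * r * P0 r ^ 4 * Q0 r"
  have "N = 0"
    unfolding N_def f_def numer_C_def numer_D_def Let_def P0_def Q0_def numer_u_def numer_du_def
      numer_ddu_def numer_dPhi2_def
    by algebra
  moreover have "?lhs = N / (r\<^sup>2 * P0 r ^ 3 * (Q0 r)\<^sup>2 * sqrt (P0 r))"
    using P0_pos[of r] Q0_pos[of r] assms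
    unfolding coeff_A_Phi2 coeff_B_Phi2 coeff_C_Phi2[OF assms] coeff_D_Phi2[OF assms]
      f_def[symmetric] N_def
    by (simp add: divide_simps) algebra
  ultimately show ?thesis by simp
qed

lemma second_component_eq_0:
  assumes "r > 0"
  shows "- (numer_ddv r / (P0 r ^ 2 * sqrt (P0 r))) - 1 / r * (numer_dv r / (P0 r * sqrt (P0 r)))
      + coeff_B Phi2 r * (numer_dv r / (P0 r * sqrt (P0 r)))
      + 9 / r\<^sup>2 * (r / sqrt (P0 r))
      + (coeff_C 2 Phi2 r - coeff_D 2 Phi2 r) * (r / sqrt (P0 r))
      + 3 * coeff_A 2 Phi2 r * (numer_u r / (P0 r * sqrt (P0 r))) = 0" (is "?lhs = 0")
proof -
  define f where "f = r\<^sup>2 * (r\<^sup>2 + 24)"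
  define N where "N = - numer_ddv r * r\<^sup>2 * (Q0 r)\<^sup>2 - numer_dv r * r * P0 r * (Q0 r)\<^sup>2
       - 2 * f * numer_dPhi2 r * numer_dv r * r\<^sup>2 * Q0 r + 9 * r * (P0 r)\<^sup>2 * (Q0 r)\<^sup>2
       + (numer_C r - numer_D r) * r + 24 * numer_u r * (P0 r)\<^sup>2 * Q0 r"
  have "N = 0"
    unfolding N_def f_def numer_C_def numer_D_def Let_def P0_def Q0_def numer_u_def numer_dv_def
      numer_ddv_def numer_dPhi2_def
    by algebra
  moreover have "?lhs = N / (r\<^sup>2 * (P0 r)\<^sup>2 * (Q0 r)\<^sup>2 * sqrt (P0 r))"
    using P0_pos[of r] Q0_pos[of r] assms
    unfolding coeff_A_Phi2 coeff_B_Phi2 coeff_C_Phi2[OF assms] coeff_D_Phi2[OF assms]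
      f_def[symmetric] N_def
    by (simp add: divide_simps) algebra
  ultimately show ?thesis by simp
qed

lemma nontrivial_kernel_element_L2:
  fixes k :: int
  assumes k: "k\<^sup>2 = 1"
  shows "nontrivial_kernel_element (L2 (3 * k))
           (\<lambda>r. numer_u r / (P0 r * sqrt (P0 r)), \<lambda>r. real_of_int k * r / sqrt (P0 r))"
    (is "nontrivial_kernel_element _ (?u, ?v)")
proof -
  define c where "c = real_of_int k"
  have c: "c\<^sup>2 = 1"
    using k unfolding c_def by (metis of_int_1 of_int_power)
  have u': "deriv ?u = (\<lambda>r. numer_du r / (P0 r ^ 2 * sqrt (P0 r)))"
    using has_real_derivative_u by (auto intro: DERIV_imp_deriv)
  have u'': "deriv (\<lambda>r. numer_du r / (P0 r ^ 2 * sqrt (P0 r))) =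
      (\<lambda>r. numer_ddu r / (P0 r ^ 3 * sqrt (P0 r)))"
    using has_real_derivative_du by (auto intro: DERIV_imp_deriv)
  have v': "deriv ?v = (\<lambda>r. c * numer_dv r / (P0 r * sqrt (P0 r)))"
    unfolding c_def using has_real_derivative_v by (auto intro: DERIV_imp_deriv)
  have v'': "deriv (\<lambda>r. c * numer_dv r / (P0 r * sqrt (P0 r))) =
      (\<lambda>r. c * numer_ddv r / (P0 r ^ 2 * sqrt (P0 r)))"
    using has_real_derivative_dv by (auto intro: DERIV_imp_deriv)
  have "twice_differentiable_pos ?u"
    unfolding twice_differentiable_pos_def u'
    using has_real_derivative_u has_real_derivative_du real_differentiable_def by blast
  moreover have "twice_differentiable_pos ?v"
    unfolding twice_differentiable_pos_def v'
    using has_real_derivative_v has_real_derivative_dv real_differentiable_def by blast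
  moreover have "fst (L2 (3 * k) (?u, ?v)) r = 0" if "r > 0" for r
  proof -
    have "c * (c * x) = x" for x
      using c by (simp add: power2_eq_square flip: mult.assoc)
    then have "fst (L2 (3 * k) (?u, ?v)) r =
        - (numer_ddu r / (P0 r ^ 3 * sqrt (P0 r))) - 1 / r * (numer_du r / (P0 r ^ 2 * sqrt (P0 r)))
        + coeff_B Phi2 r * (numer_du r / (P0 r ^ 2 * sqrt (P0 r)))
        + 9 / r\<^sup>2 * (numer_u r / (P0 r * sqrt (P0 r)))
        + (coeff_C 2 Phi2 r + coeff_D 2 Phi2 r) * (numer_u r / (P0 r * sqrt (P0 r)))
        + 3 * coeff_A 2 Phi2 r * (r / sqrt (P0 r))"
      unfolding L2_def lin_op_def prod.case fst_conv u' u''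
      by (simp add: power_mult_distrib c mult_ac flip: c_def)
    then show ?thesis
      unfolding first_component_eq_0[OF that] .
  qed
  moreover have "snd (L2 (3 * k) (?u, ?v)) r = 0" if "r > 0" for r
  proof -
    have "snd (L2 (3 * k) (?u, ?v)) r = c * (
        - (numer_ddv r / (P0 r ^ 2 * sqrt (P0 r))) - 1 / r * (numer_dv r / (P0 r * sqrt (P0 r)))
        + coeff_B Phi2 r * (numer_dv r / (P0 r * sqrt (P0 r)))
        + 9 / r\<^sup>2 * (r / sqrt (P0 r))
        + (coeff_C 2 Phi2 r - coeff_D 2 Phi2 r) * (r / sqrt (P0 r))
        + 3 * coeff_A 2 Phi2 r * (numer_u r / (P0 r * sqrt (P0 r))))"
      unfolding L2_def lin_op_def prod.case snd_conv v' v''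
      by (simp add: power_mult_distrib c algebra_simps flip: c_def)
    then show ?thesis
      unfolding second_component_eq_0[OF that] by simp
  qed
  moreover have "?v 1 \<noteq> 0"
    using k P0_pos[of 1] by auto
  ultimately show ?thesis
    unfolding nontrivial_kernel_element_def fst_conv snd_conv
    using zero_less_one by blast
qed

theorem lemma9:
  shows "nontrivial_kernel_element (L2 3)
           (\<lambda>r. - 24 * r * (r ^ 6 + 32 * r ^ 4 + 384 * r\<^sup>2 + 1536) / P0 r powr (3 / 2),
            \<lambda>r. r / sqrt (P0 r)) \<and>
         nontrivial_kernel_element (L2 (- 3))
           (\<lambda>r. - 24 * r * (r ^ 6 + 32 * r ^ 4 + 384 * r\<^sup>2 + 1536) / P0 r powr (3 / 2),
            \<lambda>r. - r / sqrt (P0 r))"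
  using nontrivial_kernel_element_L2[of 1] nontrivial_kernel_element_L2[of "- 1"]
  by (simp add: P0_powr_3_2 numer_u_def)

end
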